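(* Let $A\subset\mathbb R$ be a countable dense subset of $\mathbb R$ and let $B\subset\mathbb C$ be a countable dense subset of $\mathbb C$. There exists a transcendental entire function $f$ such that (i) the restriction $f|_A$ maps $A$ into $B$ and $f|_A\colon A\to B$ is a bijection; (ii) $f^{-1}(B)\cap\mathbb R=A$. Equivalently, every $b\in B$ has exactly one real preimage under $f$, and the collection of those preimages is $A$.
   Context: A transcendental entire function is an entire function $f\colon\mathbb C\to\mathbb C$ that is not a polynomial. *)

theory Defs
  imports "HOL-Complex_Analysis.Complex_Analysis" "HOL-Computational_Algebra.Polynomial"
begin

definition transcendental_entire :: "(complex \<Rightarrow> complex) \<Rightarrow> bool" where
  "transcendental_entire f \<longleftrightarrow> f holomorphic_on UNIV \<and> \<not> (\<exists>p :: complex poly. f = poly p)"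

end

theory Submission
  imports Defs "HOL-Computational_Algebra.Fundamental_Theorem_Algebra"
begin

text \<open>
  A back-and-forth construction: \<open>f\<close> is a locally uniform limit of polynomials \<open>p n\<close>, each carrying a
  finite set \<open>F n \<subseteq> A\<close> on which the values are frozen in \<open>B\<close>. A new point \<open>c\<close> receives a value in \<open>B\<close>
  by adding a small constant multiple of the polynomial \<open>h\<close> with root set \<open>F n\<close>; a new value \<open>b\<close> is
  attained at a far away point \<open>c \<in> A\<close> by adding \<open>t * h * (X / c) ^ k\<close>, which is small on a given disc for
  large \<open>k\<close>. Since smooth curves are null sets in the plane, a further generic perturbation makes
  every frozen value be attained only once on the real line, with nonzero derivative there. This
  survives all later steps if these change \<open>p n z\<close> by much less than \<open>norm (z - a)\<close> for each frozen \<open>a\<close>.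
  A polynomial maps the real line onto a closed null set, so the limit is not a polynomial.
\<close>

section \<open>Frozen points, controlled changes and separation\<close>

definition root_poly :: "complex set \<Rightarrow> complex poly" where
  "root_poly F = (\<Prod>a\<in>F. [:-a, 1:])"

text \<open>The two bounds serve different ends: the uniform one gives locally uniform convergence,
  also while \<open>F\<close> is empty, and the one linear in \<open>norm (z - a)\<close> prevents a
  frozen value from being attained again, even at points close to \<open>a\<close>.\<close>

definition close_on :: "real \<Rightarrow> real \<Rightarrow> complex set \<Rightarrow> complex poly \<Rightarrow> complex poly \<Rightarrow> bool" where
  "close_on r e F p p' \<longleftrightarrow>
     (\<forall>a\<in>F. poly p' a = poly p a) \<and>
     (\<forall>z. norm z \<le> r \<longrightarrow> norm (poly p' z - poly p z) \<le> e \<and>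
        (\<forall>a\<in>F. norm (poly p' z - poly p z) \<le> e * norm (z - a)))"

text \<open>
  The condition at \<open>x \<noteq> a\<close> says that \<open>p x \<noteq> p a\<close>, and at \<open>x = a\<close> that the derivative of \<open>p\<close> does not vanish.
\<close>

definition separated :: "complex poly \<Rightarrow> complex set \<Rightarrow> bool" where
  "separated p F \<longleftrightarrow> (\<forall>a\<in>F. \<forall>x\<in>\<real>. poly (synthetic_div p a) x \<noteq> 0)"

definition good :: "complex set \<Rightarrow> complex set \<Rightarrow> complex poly \<Rightarrow> complex set \<Rightarrow> bool" where
  "good A B p F \<longleftrightarrow> finite F \<and> F \<subseteq> A \<and> poly p ` F \<subseteq> B \<and> separated p F"

section \<open>Difference quotients by synthetic division\<close>

lemma poly_diff_synthetic_div:
  fixes p :: "complex poly"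
  shows "poly p x - poly p a = (x - a) * poly (synthetic_div p a) x"
proof -
  have "poly p x = poly ([:-a, 1:] * synthetic_div p a + [:poly p a:]) x"
    by (simp only: synthetic_div_correct')
  then show ?thesis
    by (simp add: algebra_simps)
qed

text \<open>Both sides agree after multiplication by \<open>[:-a, 1:]\<close>, which can be
  cancelled. The effect is that the difference quotient at \<open>a\<close> depends affinely on the
  size of a perturbation that vanishes at \<open>a\<close>.\<close>

lemma synthetic_div_add_mult:
  fixes p q :: "complex poly"
  shows "synthetic_div (p + [:-a, 1:] * q) a = synthetic_div p a + q"
proof -
  have "[:-a, 1:] * synthetic_div (p + [:-a, 1:] * q) a + [:poly p a:] =
        [:-a, 1:] * (synthetic_div p a + q) + [:poly p a:]"
    using synthetic_div_correct'[of a "p + [:-a, 1:] * q"] synthetic_div_correct'[of a p]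
    by (simp add: distrib_left del: mult_pCons_left)
  then have "[:-a, 1:] * synthetic_div (p + [:-a, 1:] * q) a = [:-a, 1:] * (synthetic_div p a + q)"
    by simp
  moreover have "[:-a, 1:] \<noteq> 0"
    by simp
  ultimately show ?thesis
    by (metis mult_left_cancel)
qed

lemma poly_root_poly: "poly (root_poly F) z = (\<Prod>a\<in>F. z - a)"
  by (simp add: root_poly_def poly_prod)

lemma poly_root_poly_eq_0_iff: "finite F \<Longrightarrow> poly (root_poly F) z = 0 \<longleftrightarrow> z \<in> F"
  by (auto simp: poly_root_poly)

lemma root_poly_remove:
  "finite F \<Longrightarrow> a \<in> F \<Longrightarrow> root_poly F = [:-a, 1:] * root_poly (F - {a})"
  unfolding root_poly_def by (rule prod.remove)

section \<open>Calculus of closeness\<close>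

lemma close_on_mono:
  "close_on r e F p p' \<Longrightarrow> r' \<le> r \<Longrightarrow> e \<le> e' \<Longrightarrow> G \<subseteq> F \<Longrightarrow> close_on r' e' G p p'"
  unfolding close_on_def
  by (meson dual_order.trans mult_right_mono norm_ge_zero subsetD)

lemma close_on_refl: "0 \<le> e \<Longrightarrow> close_on r e F p p"
  by (simp add: close_on_def)

lemma close_on_trans:
  assumes "close_on r e F p p'" and "close_on r e' F p' p''"
  shows "close_on r (e + e') F p p''"
proof -
  have tri: "norm (poly p'' z - poly p z) \<le>
      norm (poly p' z - poly p z) + norm (poly p'' z - poly p' z)" for z
    using norm_triangle_ineq[of "poly p' z - poly p z" "poly p'' z - poly p' z"] by simp
  show ?thesis
    unfolding close_on_def
  proof (intro conjI allI impI ballI)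
    show "poly p'' a = poly p a" if "a \<in> F" for a
      using assms that by (simp add: close_on_def)
    show "norm (poly p'' z - poly p z) \<le> e + e'" if "norm z \<le> r" for z
      using assms that tri[of z] unfolding close_on_def by (meson add_mono order_trans)
    show "norm (poly p'' z - poly p z) \<le> (e + e') * norm (z - a)" if "norm z \<le> r" "a \<in> F" for z a
    proof -
      have "norm (poly p' z - poly p z) \<le> e * norm (z - a)"
        "norm (poly p'' z - poly p' z) \<le> e' * norm (z - a)"
        using assms that by (auto simp: close_on_def)
      then show ?thesis
        using tri[of z] by (simp add: distrib_right)
    qed
  qed
qed

text \<open>For the linear bound the factor \<open>z - a\<close> is split off from
  \<open>root_poly F\<close>, and what remains is bounded on the disc. The resulting
  \<open>d\<close> works for all \<open>p\<close> and \<open>v\<close> at once.\<close>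

lemma close_on_add_root_poly_mult:
  assumes "finite F" and "e > 0"
  obtains d where "d > 0"
    and "\<And>p v. (\<And>z. norm z \<le> r \<Longrightarrow> norm (poly v z) \<le> d) \<Longrightarrow> close_on r e F p (p + root_poly F * v)"
proof -
  \<comment> \<open>Ranging over all subsets \<open>G\<close> gives one bound for \<open>F\<close>
    itself and for every \<open>F - {a}\<close>.\<close>
  have "bounded (\<Union>G\<in>Pow F. poly (root_poly G) ` cball 0 r)"
    using assms(1)
    by (intro bounded_UN ballI compact_imp_bounded compact_continuous_image)
       (auto intro!: continuous_intros)
  then obtain M where "M > 0"
    and "\<forall>w\<in>(\<Union>G\<in>Pow F. poly (root_poly G) ` cball 0 r). norm w \<le> M"
    unfolding bounded_pos by blast
  then have M: "norm (poly (root_poly G) z) \<le> M" if "G \<subseteq> F" "norm z \<le> r" for G z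
    using that by auto
  show ?thesis
  proof (rule that[of "e / M"])
    show "e / M > 0"
      using assms \<open>M > 0\<close> by simp
    fix p v :: "complex poly"
    assume v: "\<And>z. norm z \<le> r \<Longrightarrow> norm (poly v z) \<le> e / M"
    have le: "norm (poly (root_poly G) z * poly v z) \<le> e" if "G \<subseteq> F" "norm z \<le> r" for G z
    proof -
      have "norm (poly (root_poly G) z * poly v z) \<le> M * (e / M)"
        unfolding norm_mult using M[OF that] v[OF that(2)] \<open>M > 0\<close> by (intro mult_mono) auto
      then show ?thesis
        using \<open>M > 0\<close> by simp
    qed
    show "close_on r e F p (p + root_poly F * v)"
      unfolding close_on_def
    proof (intro conjI allI impI ballI)
      show "poly (p + root_poly F * v) a = poly p a" if "a \<in> F" for a
        using assms(1) that by (simp add: poly_root_poly_eq_0_iff)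
      show "norm (poly (p + root_poly F * v) z - poly p z) \<le> e" if "norm z \<le> r" for z
        using le[of F z] that by simp
      show "norm (poly (p + root_poly F * v) z - poly p z) \<le> e * norm (z - a)"
        if "norm z \<le> r" "a \<in> F" for z a
      proof -
        have "norm (poly (p + root_poly F * v) z - poly p z) =
            norm (z - a) * norm (poly (root_poly (F - {a})) z * poly v z)"
          unfolding root_poly_remove[OF assms(1) that(2)] by (simp add: norm_mult del: mult_pCons_left)
        also have "\<dots> \<le> norm (z - a) * e"
          using le[of "F - {a}" z] that by (intro mult_left_mono) auto
        finally show ?thesis
          by (simp add: mult.commute)
      qed
    qed
  qed
qed

section \<open>Null curves and generic perturbation\<close>

text \<open>A differentiable image of a subset of the line is null in the plane. Quotients are the
  form in which bad perturbation parameters appear; \<open>q = 1\<close> covers polynomial images of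
  the real line.\<close>

lemma negligible_poly_quotient_image:
  fixes p q :: "complex poly"
  shows "negligible ((\<lambda>x::real. poly p (of_real x) / poly q (of_real x)) ` {x. poly q (of_real x) \<noteq> 0})"
proof (rule negligible_differentiable_image_lowdim)
  show "DIM(real) < DIM(complex)"
    by simp
  have "(\<lambda>x. poly r (complex_of_real x)) differentiable at x within S" for r :: "complex poly" and x S
  proof -
    have "(poly r has_field_derivative poly (pderiv r) (of_real x)) (at (of_real x))"
      by (rule poly_DERIV)
    then show ?thesis
      unfolding differentiable_def
      by (intro exI) (rule has_derivative_compose[OF has_derivative_of_real[OF has_derivative_ident]],
        simp add: has_field_derivative_def)
  qed
  then show "(\<lambda>x::real. poly p (of_real x) / poly q (of_real x)) differentiable_on {x. poly q (of_real x) \<noteq> 0}"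
    unfolding differentiable_on_def by (intro ballI differentiable_divide) auto
qed

text \<open>The perturbed difference quotient at \<open>a\<close> is affine in \<open>\<mu>\<close>.
  A real zero \<open>x\<close> with nonzero coefficient of \<open>\<mu>\<close> determines
  \<open>\<mu>\<close>, so it puts \<open>\<mu>\<close> on one of finitely many null curves. If the
  coefficient vanishes, \<open>x\<close> is another point of \<open>F\<close> with the same value
  under \<open>p\<close>, contrary to injectivity.\<close>

lemma separated_perturbation:
  assumes "finite F" and "F \<subseteq> \<real>" and "inj_on (poly p) F" and "d > 0"
  obtains \<mu> where "norm \<mu> < d" and "separated (p + smult \<mu> (root_poly F)) F"
proof -
  define h where "h a = root_poly (F - {a})" for a
  \<comment> \<open>the parameters for which the difference quotient at some \<open>a\<close> acquires a real root outside \<open>F - {a}\<close>\<close>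
  define N where "N = (\<Union>a\<in>F. (\<lambda>x::real. poly (- synthetic_div p a) (of_real x) / poly (h a) (of_real x))
      ` {x. poly (h a) (of_real x) \<noteq> 0})"
  have "negligible N"
    unfolding N_def using assms(1)
    by (intro negligible_Union) (auto simp del: poly_minus intro: negligible_poly_quotient_image)
  then have "\<not> ball 0 d \<subseteq> N"
    using assms(4) by (metis ball_eq_empty not_less open_ball open_not_negligible negligible_subset)
  then obtain \<mu> where \<mu>: "norm \<mu> < d" "\<mu> \<notin> N"
    unfolding subset_iff mem_ball_0 by blast
  have "separated (p + smult \<mu> (root_poly F)) F"
    unfolding separated_def
  proof (intro ballI notI)
    fix a x :: complex
    assume a: "a \<in> F" and "x \<in> \<real>"
      and *: "poly (synthetic_div (p + smult \<mu> (root_poly F)) a) x = 0"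
    then obtain t where t: "x = of_real t"
      by (auto elim: Reals_cases)
    have "p + smult \<mu> (root_poly F) = p + [:-a, 1:] * smult \<mu> (h a)"
      unfolding h_def root_poly_remove[OF assms(1) a] by (simp only: mult_smult_right)
    then have eq: "poly (synthetic_div p a) x + \<mu> * poly (h a) x = 0"
      using * by (simp add: synthetic_div_add_mult del: mult_smult_right mult_pCons_left)
    show False
    proof (cases "poly (h a) x = 0")
      case True
      then have "x \<in> F" "x \<noteq> a"
        using assms(1) by (auto simp: h_def poly_root_poly_eq_0_iff)
      moreover have "poly p x = poly p a"
        using poly_diff_synthetic_div[of p x a] eq True by simp
      ultimately show False
        using assms(3) a by (auto dest: inj_onD)
    next
      case False
      then have "\<mu> = poly (- synthetic_div p a) x / poly (h a) x"
        using eq by (simp add: field_simps eq_neg_iff_add_eq_0 add.commute)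
      then have "\<mu> \<in> N"
        using False a unfolding N_def t by auto
      then show False
        using \<mu> by simp
    qed
  qed
  then show ?thesis
    using \<mu>(1) that by blast
qed

section \<open>Consequences of separation\<close>

lemma separated_imp_inj_on:
  assumes "separated p F" and "F \<subseteq> \<real>"
  shows "inj_on (poly p) F"
proof (rule inj_onI)
  fix x y assume "x \<in> F" "y \<in> F" "poly p x = poly p y"
  then show "x = y"
    using assms poly_diff_synthetic_div[of p x y] by (auto simp: separated_def)
qed

text \<open>Each difference quotient is continuous and has no zero on the compact set of reals in
  the disc, so its modulus is bounded below there. The minimum over the finite set \<open>F\<close>
  is taken by induction.\<close>

lemma separated_imp_expanding:
  assumes "finite F" and "separated p F"
  obtains \<delta> where "\<delta> > 0"
    and "\<And>a x. a \<in> F \<Longrightarrow> x \<in> \<real> \<Longrightarrow> norm x \<le> r \<Longrightarrow> \<delta> * norm (x - a) \<le> norm (poly p x - poly p a)"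
proof -
  have "\<exists>\<delta>>0. \<forall>a\<in>F. \<forall>x\<in>\<real> \<inter> cball 0 r. \<delta> \<le> norm (poly (synthetic_div p a) x)"
    using assms
  proof (induction F)
    case empty
    show ?case
      by (auto intro: exI[of _ 1])
  next
    case (insert a F)
    then obtain \<delta> where \<delta>: "\<delta> > 0" "\<forall>a\<in>F. \<forall>x\<in>\<real> \<inter> cball 0 r. \<delta> \<le> norm (poly (synthetic_div p a) x)"
      by (auto simp: separated_def)
    have "compact (poly (synthetic_div p a) ` (\<real> \<inter> cball 0 r))"
      by (intro compact_continuous_image closed_Int_compact closed_complex_Reals) (auto intro!: continuous_intros)
    moreover have "0 \<notin> poly (synthetic_div p a) ` (\<real> \<inter> cball 0 r)"
      using insert.prems by (auto simp: separated_def)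
    ultimately obtain \<eta> where "\<eta> > 0" "\<forall>w\<in>poly (synthetic_div p a) ` (\<real> \<inter> cball 0 r). \<eta> \<le> dist 0 w"
      using separate_point_closed compact_imp_closed by metis
    then show ?case
      using \<delta> by (intro exI[of _ "min \<delta> \<eta>"]) (auto intro: min.coboundedI1 min.coboundedI2)
  qed
  then obtain \<delta> where \<delta>: "\<delta> > 0" "\<forall>a\<in>F. \<forall>x\<in>\<real> \<inter> cball 0 r. \<delta> \<le> norm (poly (synthetic_div p a) x)"
    by blast
  show ?thesis
  proof (rule that[OF \<delta>(1)])
    fix a x :: complex assume "a \<in> F" "x \<in> \<real>" "norm x \<le> r"
    then have "\<delta> \<le> norm (poly (synthetic_div p a) x)"
      using \<delta>(2) by simp
    then show "\<delta> * norm (x - a) \<le> norm (poly p x - poly p a)"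
      by (simp add: poly_diff_synthetic_div norm_mult mult.commute[of \<delta>] mult_left_mono)
  qed
qed

section \<open>Freezing a new point or a new value\<close>

text \<open>The correction \<open>u\<close> prescribes the value at \<open>c\<close>; adding a small
  multiple of \<open>[:-c, 1:]\<close> to it then restores separation without changing that value.
  As \<open>d\<close> is fixed before \<open>u\<close> and \<open>c\<close>, both may be chosen in
  terms of \<open>d\<close>.\<close>

lemma extend_by_point:
  assumes "finite F" and "F \<subseteq> \<real>" and "inj_on (poly p) F" and "e > 0"
  obtains d where "d > 0"
    and "\<And>u c. c \<in> \<real> - F \<Longrightarrow> (\<And>z. norm z \<le> r \<Longrightarrow> norm (poly u z) \<le> d) \<Longrightarrow>
      poly (p + root_poly F * u) c \<notin> poly p ` F \<Longrightarrow>
      \<exists>p'. close_on r e F p p' \<and> poly p' c = poly (p + root_poly F * u) c \<and> separated p' (insert c F)"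
proof -
  obtain d where d: "d > 0" and close:
    "\<And>p v. (\<And>z. norm z \<le> r \<Longrightarrow> norm (poly v z) \<le> d) \<Longrightarrow> close_on r e F p (p + root_poly F * v)"
    using close_on_add_root_poly_mult[OF assms(1,4)] by metis
  show ?thesis
  proof (rule that[of "d / 2"])
    fix u c
    assume c: "c \<in> \<real> - F" and u: "\<And>z. norm z \<le> r \<Longrightarrow> norm (poly u z) \<le> d / 2"
      and new: "poly (p + root_poly F * u) c \<notin> poly p ` F"
    let ?p = "p + root_poly F * u"
    have same: "poly ?p a = poly p a" if "a \<in> F" for a
      using that assms(1) by (simp add: poly_root_poly_eq_0_iff)
    have "inj_on (poly ?p) (insert c F)"
      using assms(3) new c same unfolding inj_on_insert by (auto simp: inj_on_def simp del: poly_add)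
    \<comment> \<open>The denominator bounds \<open>norm (z - c)\<close> on the disc, and the 1
      makes it positive. Half of \<open>d\<close> is reserved for \<open>u\<close>, the other half
      for this perturbation.\<close>
    moreover have "d / 2 / (\<bar>r\<bar> + norm c + 1) > 0"
      using d by (intro divide_pos_pos) (auto intro: add_nonneg_pos)
    ultimately obtain \<mu> where \<mu>: "norm \<mu> < d / 2 / (\<bar>r\<bar> + norm c + 1)"
      and sep: "separated (?p + smult \<mu> (root_poly (insert c F))) (insert c F)"
      using separated_perturbation[of "insert c F" ?p] assms(1,2) c by auto
    have root: "root_poly (insert c F) = [:-c, 1:] * root_poly F"
      using assms(1) c by (simp add: root_poly_def)
    have eq: "?p + smult \<mu> (root_poly (insert c F)) = p + root_poly F * (u + smult \<mu> [:-c, 1:])"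
      unfolding root by (simp only: distrib_left mult_smult_left mult_smult_right add.assoc mult.commute)
    have "close_on r e F p (p + root_poly F * (u + smult \<mu> [:-c, 1:]))"
    proof (rule close)
      fix z :: complex assume z: "norm z \<le> r"
      have "norm (\<mu> * (z - c)) \<le> d / 2 / (\<bar>r\<bar> + norm c + 1) * (\<bar>r\<bar> + norm c + 1)"
        unfolding norm_mult using \<mu> z norm_triangle_ineq4[of z c] d by (intro mult_mono) auto
      also have "\<dots> = d / 2"
        by (simp add: field_simps add_nonneg_eq_0_iff)
      finally have "norm (poly u z + \<mu> * (z - c)) \<le> d / 2 + d / 2"
        using u[OF z] by (intro norm_triangle_mono)
      then show "norm (poly (u + smult \<mu> [:-c, 1:]) z) \<le> d"
        by (simp add: algebra_simps)
    qed
    moreover have "poly (?p + smult \<mu> (root_poly (insert c F))) c = poly ?p c"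
      using assms(1) by (simp add: poly_root_poly_eq_0_iff)
    ultimately show "\<exists>p'. close_on r e F p p' \<and> poly p' c = poly ?p c \<and> separated p' (insert c F)"
      using sep unfolding eq by blast
  qed (use d in simp)
qed

lemma good_insert:
  assumes "good A B p F" and "close_on r e F p p'" and "separated p' (insert c F)"
    and "c \<in> A" and "poly p' c \<in> B"
  shows "good A B p' (insert c F)"
  using assms by (auto simp: good_def close_on_def)

text \<open>A disc around \<open>poly p c\<close> minus the finitely many frozen values is open and
  nonempty, so it meets the dense set \<open>B\<close>. A constant \<open>u\<close> moves the value
  at \<open>c\<close> to such a point.\<close>

lemma extend_domain:
  assumes "good A B p F" and "A \<subseteq> \<real>" and "closure B = UNIV" and "e > 0" and "c \<in> A"
  obtains p' F' where "good A B p' F'" and "F \<subseteq> F'" and "c \<in> F'" and "close_on r e F p p'"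
proof (cases "c \<in> F")
  case True
  then show ?thesis
    using assms(4) by (intro that[OF assms(1) order_refl]) (auto intro: close_on_refl)
next
  case False
  have F: "finite F" "F \<subseteq> \<real>" "inj_on (poly p) F"
    using assms(1,2) separated_imp_inj_on[of p F] by (auto simp: good_def)
  let ?h = "poly (root_poly F) c"
  have h: "?h \<noteq> 0"
    using False F(1) by (simp add: poly_root_poly_eq_0_iff)
  obtain d where "d > 0" and d: "\<And>u c. c \<in> \<real> - F \<Longrightarrow> (\<And>z. norm z \<le> r \<Longrightarrow> norm (poly u z) \<le> d) \<Longrightarrow>
      poly (p + root_poly F * u) c \<notin> poly p ` F \<Longrightarrow>
      \<exists>p'. close_on r e F p p' \<and> poly p' c = poly (p + root_poly F * u) c \<and> separated p' (insert c F)"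
    using extend_by_point[OF F assms(4)] by metis
  have "infinite (ball (poly p c) (d * norm ?h))"
    using \<open>d > 0\<close> h by (intro uncountable_infinite uncountable_ball) simp
  then have "ball (poly p c) (d * norm ?h) - poly p ` F \<noteq> {}"
    using F(1) by (metis Diff_eq_empty_iff finite_imageI finite_subset)
  moreover have "open (ball (poly p c) (d * norm ?h) - poly p ` F)"
    using F(1) by (intro open_Diff finite_imp_closed) auto
  ultimately have "(ball (poly p c) (d * norm ?h) - poly p ` F) \<inter> B \<noteq> {}"
    using open_Int_closure_eq_empty[of "ball (poly p c) (d * norm ?h) - poly p ` F" B] assms(3) by simp
  then obtain b where b: "b \<in> B" "b \<notin> poly p ` F" "norm (b - poly p c) < d * norm ?h"
    by (auto simp: dist_norm norm_minus_commute)
  have at_c: "poly (p + root_poly F * [:(b - poly p c) / ?h:]) c = b"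
    using h by simp
  have "\<exists>p'. close_on r e F p p' \<and> poly p' c = poly (p + root_poly F * [:(b - poly p c) / ?h:]) c
      \<and> separated p' (insert c F)"
  proof (rule d)
    show "c \<in> \<real> - F"
      using False assms by auto
    show "norm (poly [:(b - poly p c) / ?h:] z) \<le> d" for z
      using b(3) h by (simp add: norm_divide divide_le_eq)
  qed (use at_c b in simp)
  then obtain p' where "close_on r e F p p'" "poly p' c = b" "separated p' (insert c F)"
    using at_c by auto
  then show ?thesis
    using that[of p' "insert c F"] good_insert[OF assms(1)] assms(5) b(1) by blast
qed

text \<open>Unboundedness of \<open>A\<close> supplies \<open>c\<close> with
  \<open>norm (z / c) \<le> 1 / 2\<close> on the disc, so that \<open>t * (z / c) ^ n\<close> equals
  \<open>t\<close> at \<open>c\<close> but is as small as desired on the disc.\<close>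

lemma extend_range:
  assumes "good A B p F" and "A \<subseteq> \<real>" and "\<not> bounded A" and "e > 0" and "b \<in> B"
  obtains p' F' where "good A B p' F'" and "F \<subseteq> F'" and "b \<in> poly p' ` F'" and "close_on r e F p p'"
proof (cases "b \<in> poly p ` F")
  case True
  then show ?thesis
    using assms(4) by (intro that[OF assms(1) order_refl]) (auto intro: close_on_refl)
next
  case False
  have F: "finite F" "F \<subseteq> \<real>" "inj_on (poly p) F"
    using assms(1,2) separated_imp_inj_on[of p F] by (auto simp: good_def)
  obtain d where "d > 0" and d: "\<And>u c. c \<in> \<real> - F \<Longrightarrow> (\<And>z. norm z \<le> r \<Longrightarrow> norm (poly u z) \<le> d) \<Longrightarrow>
      poly (p + root_poly F * u) c \<notin> poly p ` F \<Longrightarrow>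
      \<exists>p'. close_on r e F p p' \<and> poly p' c = poly (p + root_poly F * u) c \<and> separated p' (insert c F)"
    using extend_by_point[OF F assms(4)] by metis
  have "\<not> A \<subseteq> F \<union> cball 0 (2 * \<bar>r\<bar>)"
    using assms(3) F(1) by (meson bounded_Un bounded_cball bounded_subset finite_imp_bounded)
  then obtain c where c: "c \<in> A" "c \<notin> F" "norm c > 2 * \<bar>r\<bar>"
    unfolding subset_iff Un_iff mem_cball_0 not_less[symmetric] by blast
  let ?h = "poly (root_poly F) c"
  have h: "?h \<noteq> 0"
    using c(2) F(1) by (simp add: poly_root_poly_eq_0_iff)
  define t where "t = (b - poly p c) / ?h"
  \<comment> \<open>\<open>norm t + 1\<close> replaces \<open>norm t\<close> because
    \<open>t\<close> is zero if \<open>p\<close> already has the value \<open>b\<close> at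
    \<open>c\<close>.\<close>
  obtain n where n: "(1/2) ^ n < d / (norm t + 1)"
    using real_arch_pow_inv[of "d / (norm t + 1)" "1/2"] \<open>d > 0\<close> by (auto simp: add_nonneg_pos)
  define u where "u = smult t ([:0, 1 / c:] ^ n)"
  have "c \<noteq> 0"
    using c(3) by auto
  then have at_c: "poly (p + root_poly F * u) c = b"
    using h by (simp add: u_def t_def poly_power)
  have "\<exists>p'. close_on r e F p p' \<and> poly p' c = poly (p + root_poly F * u) c \<and> separated p' (insert c F)"
  proof (rule d)
    show "c \<in> \<real> - F"
      using c assms by auto
    fix z :: complex assume "norm z \<le> r"
    then have "norm (z / c) \<le> 1 / 2"
      using c(3) \<open>c \<noteq> 0\<close> by (simp add: norm_divide divide_le_eq)
    then have "norm (z / c) ^ n \<le> (1/2) ^ n"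
      by (intro power_mono) auto
    then have "norm t * norm (z / c) ^ n \<le> (norm t + 1) * (d / (norm t + 1))"
      using n by (intro mult_mono) auto
    also have "\<dots> = d"
      by (simp add: add_nonneg_eq_0_iff)
    finally show "norm (poly u z) \<le> d"
      by (simp add: u_def poly_power norm_mult norm_power)
  qed (use at_c False in simp)
  then obtain p' where "close_on r e F p p'" "poly p' c = b" "separated p' (insert c F)"
    using at_c by auto
  then show ?thesis
    using that[of p' "insert c F"] good_insert[OF assms(1)] assms(5) c(1) by blast
qed

lemma back_and_forth_step:
  assumes "good A B p F" and "A \<subseteq> \<real>" and "\<not> bounded A" and "closure B = UNIV"
    and "e > 0" and "a \<in> A" and "b \<in> B"
  obtains p' F' where "good A B p' F'" and "F \<subseteq> F'" and "a \<in> F'" and "b \<in> poly p' ` F'"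
    and "close_on r e F p p'"
proof -
  obtain q G where q: "good A B q G" "F \<subseteq> G" "a \<in> G" "close_on r (e/2) F p q"
    using extend_domain[OF assms(1,2,4) _ assms(6), of "e/2" r] assms(5) by auto
  obtain p' F' where p': "good A B p' F'" "G \<subseteq> F'" "b \<in> poly p' ` F'" "close_on r (e/2) G q p'"
    using extend_range[OF q(1) assms(2,3) _ assms(7), of "e/2" r] assms(5) by auto
  have "close_on r e F p p'"
    using close_on_trans[OF q(4) close_on_mono[OF p'(4) order_refl order_refl q(2)]] by simp
  then show ?thesis
    using that[OF p'(1)] p'(2,3) q(2,3) by blast
qed

section \<open>Passage to the limit\<close>

lemma close_on_limit:
  fixes p :: "nat \<Rightarrow> complex poly"
  assumes close: "\<And>n. close_on (real n) (e n) (F n) (p n) (p (Suc n))"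
    and F: "\<And>n. F n \<subseteq> F (Suc n)" and e: "\<And>n. e n > 0" "\<And>n. 2 * e (Suc n) \<le> e n"
  obtains f where "f holomorphic_on UNIV"
    and "\<And>n a. a \<in> F n \<Longrightarrow> f a = poly (p n) a"
    and "\<And>n a z. a \<in> F n \<Longrightarrow> norm z \<le> real n \<Longrightarrow> norm (f z - poly (p n) z) \<le> 2 * e n * norm (z - a)"
proof -
  define f where "f z = lim (\<lambda>n. poly (p n) z)" for z
  \<comment> \<open>The term \<open>- 2 * e m\<close> lets the induction close: the next step costs
    \<open>e m\<close>, and \<open>2 * e (Suc m) \<le> e m\<close> pays for it.\<close>
  have telescope: "close_on (real n) (2 * e n - 2 * e m) (F n) (p n) (p m)" if "n \<le> m" for n m
    using that
  proof (induction m rule: dec_induct)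
    case base
    show ?case
      by (simp add: close_on_refl)
  next
    case (step m)
    have "F n \<subseteq> F m"
      using F step.hyps(1) by (rule lift_Suc_mono_le)
    then have "close_on (real n) (e m) (F n) (p m) (p (Suc m))"
      using close_on_mono[OF close] step.hyps(1) by simp
    then have "close_on (real n) (2 * e n - 2 * e m + e m) (F n) (p n) (p (Suc m))"
      by (rule close_on_trans[OF step.IH])
    then show ?case
      by (rule close_on_mono) (use e(2)[of m] in auto)
  qed
  have tail: "close_on (real n) (2 * e n) (F n) (p n) (p m)" if "n \<le> m" for n m
    by (rule close_on_mono[OF telescope[OF that]]) (use e(1)[of m] in auto)
  have e_le: "e n \<le> e 0 * (1/2) ^ n" for n
  proof (induction n)
    case (Suc n)
    then show ?case
      using e(2)[of n] by simp
  qed simp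
  have "(\<lambda>n. e 0 * (1/2) ^ n) \<longlonglongrightarrow> 0"
    by (intro tendsto_mult_right_zero LIMSEQ_power_zero) simp
  then have "e \<longlonglongrightarrow> 0"
    by (rule Lim_null_comparison[rotated]) (use e_le less_imp_le[OF e(1)] in simp)
  have unif: "uniform_limit (cball 0 r) (\<lambda>n z. poly (p n) z) f sequentially" for r
  proof -
    have "uniformly_Cauchy_on (cball 0 r) (\<lambda>n z. poly (p n) z)"
    proof (rule uniformly_Cauchy_onI)
      fix \<epsilon> :: real assume "\<epsilon> > 0"
      then have "\<forall>\<^sub>F n in sequentially. e n < \<epsilon> / 4"
        by (intro order_tendstoD(2)[OF \<open>e \<longlonglongrightarrow> 0\<close>]) simp
      \<comment> \<open>Stage \<open>n\<close> controls only the disc of radius \<open>n\<close>, so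
        the stage must also be late enough for this disc to contain the given one.\<close>
      then have "\<forall>\<^sub>F n in sequentially. e n < \<epsilon> / 4 \<and> r \<le> real n"
        by (intro eventually_conj eventually_ge_at_top[THEN eventually_compose_filterlim]
            filterlim_real_sequentially)
      then obtain N where N: "e N < \<epsilon> / 4" "r \<le> real N"
        unfolding eventually_sequentially by blast
      have near: "dist (poly (p m) z) (poly (p N) z) < \<epsilon> / 2" if "z \<in> cball 0 r" "m \<ge> N" for z m
      proof -
        have "norm (poly (p m) z - poly (p N) z) \<le> 2 * e N"
          using tail[OF that(2)] that(1) N(2) by (auto simp: close_on_def)
        then show ?thesis
          using N(1) by (simp add: dist_norm)
      qed
      show "\<exists>M. \<forall>z\<in>cball 0 r. \<forall>m\<ge>M. \<forall>n\<ge>M. dist (poly (p m) z) (poly (p n) z) < \<epsilon>"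
        using near by (intro exI[of _ N]) (metis dist_triangle_half_l dist_commute)
    qed
    then show ?thesis
      unfolding f_def by (simp add: Cauchy_uniformly_convergent flip: uniformly_convergent_uniform_limit_iff)
  qed
  have lim: "(\<lambda>n. poly (p n) z) \<longlonglongrightarrow> f z" for z
    by (rule tendsto_uniform_limitI[OF unif[of "norm z"]]) simp
  show ?thesis
  proof (rule that[of f])
    show "f holomorphic_on UNIV"
    proof (rule holomorphic_uniform_sequence[where f = "\<lambda>n z. poly (p n) z"])
      fix z :: complex
      have "uniform_limit (cball z 1) (\<lambda>n z. poly (p n) z) f sequentially"
      proof (rule uniform_limit_on_subset[OF unif[of "norm z + 1"]])
        show "cball z 1 \<subseteq> cball 0 (norm z + 1)"
        proof
          fix x assume "x \<in> cball z 1"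
          then show "x \<in> cball 0 (norm z + 1)"
            using norm_triangle_sub[of x z] by (simp add: dist_norm norm_minus_commute)
        qed
      qed
      then show "\<exists>d>0. cball z d \<subseteq> UNIV \<and> uniform_limit (cball z d) (\<lambda>n z. poly (p n) z) f sequentially"
        by (intro exI[of _ 1]) simp
    qed (auto intro!: holomorphic_intros)
    fix n a assume a: "a \<in> F n"
    have "\<forall>\<^sub>F m in sequentially. poly (p m) a = poly (p n) a"
      using eventually_ge_at_top[of n] by eventually_elim (use tail a in \<open>auto simp: close_on_def\<close>)
    then show "f a = poly (p n) a"
      using LIMSEQ_unique[OF lim] by (metis tendsto_eventually)
    fix z :: complex assume z: "norm z \<le> real n"
    have "(\<lambda>m. norm (poly (p m) z - poly (p n) z)) \<longlonglongrightarrow> norm (f z - poly (p n) z)"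
      by (intro tendsto_intros lim)
    then show "norm (f z - poly (p n) z) \<le> 2 * e n * norm (z - a)"
      by (rule LIMSEQ_le_const2) (use tail a z in \<open>auto simp: close_on_def intro!: exI[of _ n]\<close>)
  qed
qed

section \<open>Why the limit is not a polynomial\<close>

text \<open>A nonconstant polynomial has modulus at least 1 far out, so the part of \<open>B\<close>
  in the open unit disc lies in the image of a compact real set. By density this image, which is
  null, would contain the whole disc.\<close>

lemma dense_subset_poly_image_Reals:
  fixes p :: "complex poly"
  assumes "closure B = UNIV" shows "\<not> B \<subseteq> poly p ` \<real>"
proof
  assume B: "B \<subseteq> poly p ` \<real>"
  have "\<exists>K. compact K \<and> K \<subseteq> poly p ` \<real> \<and> B \<inter> ball 0 1 \<subseteq> K"
  proof (cases "degree p = 0")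
    case True
    then obtain c where "p = [:c:]"
      by (metis degree_eq_zeroE)
    then show ?thesis
      using B by (intro exI[of _ "{c}"]) (auto intro: image_eqI[of _ _ 0])
  next
    case False
    obtain a q where p: "p = pCons a q"
      by (rule pCons_cases)
    with False have "q \<noteq> 0"
      by auto
    then obtain r where r: "\<And>z. r \<le> norm z \<Longrightarrow> norm (poly p z) \<ge> 1"
      unfolding p using poly_infinity[of q 1 a] by auto
    have "compact (poly p ` (\<real> \<inter> cball 0 r))"
      by (intro compact_continuous_image closed_Int_compact closed_complex_Reals) (auto intro!: continuous_intros)
    moreover have "B \<inter> ball 0 1 \<subseteq> poly p ` (\<real> \<inter> cball 0 r)"
    proof
      fix b assume b: "b \<in> B \<inter> ball 0 1"
      then obtain z where "z \<in> \<real>" "b = poly p z"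
        using B by auto
      then show "b \<in> poly p ` (\<real> \<inter> cball 0 r)"
        using b r[of z] by (cases "r \<le> norm z") auto
    qed
    ultimately show ?thesis
      by blast
  qed
  then obtain K where K: "compact K" "K \<subseteq> poly p ` \<real>" "B \<inter> ball 0 1 \<subseteq> K"
    by blast
  have "ball 0 1 \<subseteq> closure (ball 0 1 \<inter> B)"
    using open_Int_closure_subset[of "ball 0 1" B] assms by simp
  also have "\<dots> \<subseteq> K"
    using K by (intro closure_minimal compact_imp_closed) auto
  finally have "ball 0 1 \<subseteq> poly p ` \<real>"
    using K(2) by blast
  moreover have "negligible (poly p ` \<real>)"
    using negligible_poly_quotient_image[of p 1] by (simp add: Reals_def image_image)
  ultimately have "negligible (ball (0::complex) 1)"
    using negligible_subset by blast
  then show False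
    using open_not_negligible[of "ball (0::complex) 1"] by simp
qed

section \<open>The back-and-forth construction\<close>

lemma exists_entire_bijection:
  fixes A B :: "complex set"
  assumes "countable A" and "A \<subseteq> \<real>" and "\<not> bounded A" and "countable B" and "closure B = UNIV"
  obtains f where "f holomorphic_on UNIV" and "bij_betw f A B" and "f -` B \<inter> \<real> = A"
proof -
  have ne: "A \<noteq> {}" "B \<noteq> {}"
    using assms(3,5) by auto
  \<comment> \<open>The factor 3 is chosen to beat the factor 2 in the total later change
    \<open>2 * e * norm (x - a)\<close>.\<close>
  define P where "P n = (\<lambda>(p, F, e). good A B p F \<and> e > (0::real) \<and>
      (\<forall>a\<in>F. \<forall>x\<in>\<real>. norm x \<le> real n \<longrightarrow> 3 * e * norm (x - a) \<le> norm (poly p x - poly p a)))" for n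
  define Q where "Q n = (\<lambda>(p, F, e) (p', F', e'). F \<subseteq> F' \<and> from_nat_into A n \<in> F' \<and>
      from_nat_into B n \<in> poly p' ` F' \<and> close_on (real n) e F p p' \<and> 2 * e' \<le> (e::real))" for n
  have "\<exists>s. \<forall>n. P n (s n) \<and> Q n (s n) (s (Suc n))"
  proof (rule dependent_nat_choice)
    have "P 0 (0, {}, 1)"
      by (simp add: P_def good_def separated_def)
    then show "\<exists>s. P 0 s" ..
  next
    fix s n assume "P n s"
    moreover obtain p F e where s: "s = (p, F, e)"
      by (cases s)
    ultimately have "good A B p F" "e > 0"
      by (auto simp: P_def)
    then obtain p' F' where p': "good A B p' F'" "F \<subseteq> F'" "from_nat_into A n \<in> F'"
        "from_nat_into B n \<in> poly p' ` F'" "close_on (real n) e F p p'"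
      using back_and_forth_step[OF _ assms(2,3,5) _ from_nat_into[OF ne(1)] from_nat_into[OF ne(2)]]
      by metis
    obtain \<delta> where \<delta>: "\<delta> > 0" "\<And>a x. a \<in> F' \<Longrightarrow> x \<in> \<real> \<Longrightarrow> norm x \<le> real (Suc n) \<Longrightarrow>
        \<delta> * norm (x - a) \<le> norm (poly p' x - poly p' a)"
      using separated_imp_expanding[of F' p'] p'(1) unfolding good_def by metis
    \<comment> \<open>\<open>\<delta> / 3\<close> gives the expansion bound at stage
      \<open>Suc n\<close>, and \<open>e / 2\<close> the halving that makes the errors
      summable.\<close>
    define e' where "e' = min (\<delta> / 3) (e / 2)"
    have "3 * e' * norm (x - a) \<le> norm (poly p' x - poly p' a)"
      if "a \<in> F'" "x \<in> \<real>" "norm x \<le> real (Suc n)" for a x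
    proof -
      have "3 * e' * norm (x - a) \<le> \<delta> * norm (x - a)"
        by (intro mult_right_mono) (auto simp: e'_def)
      also have "\<dots> \<le> norm (poly p' x - poly p' a)"
        using \<delta>(2) that .
      finally show ?thesis .
    qed
    then have "P (Suc n) (p', F', e')" "Q n s (p', F', e')"
      using p' \<delta>(1) \<open>e > 0\<close> by (auto simp: P_def Q_def s e'_def)
    then show "\<exists>s'. P (Suc n) s' \<and> Q n s s'"
      by blast
  qed
  then obtain s where s: "\<And>n. P n (s n)" "\<And>n. Q n (s n) (s (Suc n))"
    by blast
  define p where "p n = fst (s n)" for n
  define F where "F n = fst (snd (s n))" for n
  define e where "e n = snd (snd (s n))" for n
  have s_eq: "s n = (p n, F n, e n)" for n
    by (simp add: p_def F_def e_def)
  have good: "good A B (p n) (F n)" and e_pos: "e n > 0" for n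
    using s(1)[of n] by (auto simp: P_def s_eq)
  have expanding: "3 * e n * norm (x - a) \<le> norm (poly (p n) x - poly (p n) a)"
    if "a \<in> F n" "x \<in> \<real>" "norm x \<le> real n" for n a x
    using s(1)[of n] that by (auto simp: P_def s_eq)
  have F_Suc: "F n \<subseteq> F (Suc n)" and A_F: "from_nat_into A n \<in> F (Suc n)"
    and B_F: "from_nat_into B n \<in> poly (p (Suc n)) ` F (Suc n)"
    and close: "close_on (real n) (e n) (F n) (p n) (p (Suc n))" and e_Suc: "2 * e (Suc n) \<le> e n" for n
    using s(2)[of n] by (auto simp: Q_def s_eq)
  obtain f where f: "f holomorphic_on UNIV" "\<And>n a. a \<in> F n \<Longrightarrow> f a = poly (p n) a"
    "\<And>n a z. a \<in> F n \<Longrightarrow> norm z \<le> real n \<Longrightarrow> norm (f z - poly (p n) z) \<le> 2 * e n * norm (z - a)"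
    using close_on_limit[OF close F_Suc e_pos e_Suc] by metis
  have in_F: "\<exists>n. a \<in> F n" if "a \<in> A" for a
    using from_nat_into_surj[OF assms(1) that] A_F by blast
  have f_A: "f a \<in> B" if "a \<in> A" for a
    using in_F[OF that] f(2) good unfolding good_def by (metis image_subset_iff)
  have f_B: "\<exists>a\<in>A. f a = b" if "b \<in> B" for b
  proof -
    obtain n where "from_nat_into B n = b"
      using from_nat_into_surj[OF assms(4) \<open>b \<in> B\<close>] by blast
    then obtain a where "a \<in> F (Suc n)" "b = poly (p (Suc n)) a"
      using B_F[of n] by blast
    then show ?thesis
      using f(2) good[of "Suc n"] by (auto simp: good_def)
  qed
  \<comment> \<open>At a stage where \<open>a\<close> is frozen and the disc contains
    \<open>x\<close>, equality \<open>f x = f a\<close> would force an expansion of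
    \<open>3 * e n * norm (x - a)\<close> to be undone by a change of at most
    \<open>2 * e n * norm (x - a)\<close>.\<close>
  have unique: "x = a" if "a \<in> A" "x \<in> \<real>" "f x = f a" for a x
  proof -
    obtain m where "a \<in> F m"
      using in_F \<open>a \<in> A\<close> by blast
    obtain n where n: "m \<le> n" "norm x \<le> real n"
      by (metis (no_types) linorder_le_cases of_nat_le_iff order_trans real_arch_simple)
    then have a: "a \<in> F n"
      using \<open>a \<in> F m\<close> lift_Suc_mono_le[of F, OF F_Suc] by blast
    have "3 * e n * norm (x - a) \<le> norm (poly (p n) x - f x)"
      using expanding[OF a that(2) n(2)] f(2)[OF a] that(3) by simp
    also have "\<dots> \<le> 2 * e n * norm (x - a)"
      using f(3)[OF a n(2)] by (simp add: norm_minus_commute)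
    finally have "e n * norm (x - a) \<le> 0"
      by simp
    then show ?thesis
      using e_pos[of n] by (simp add: mult_le_0_iff)
  qed
  show ?thesis
  proof (rule that[OF f(1)])
    have "inj_on f A"
      using unique assms(2) by (intro inj_onI) blast
    then show "bij_betw f A B"
      using f_A f_B unfolding bij_betw_def by blast
    \<comment> \<open>Any value in \<open>B\<close> is attained at some point of \<open>A\<close>,
      and by \<open>unique\<close> at no other real point.\<close>
    show "f -` B \<inter> \<real> = A"
    proof (intro equalityI subsetI)
      fix x assume "x \<in> f -` B \<inter> \<real>"
      then show "x \<in> A"
        using f_B unique by (metis Int_iff vimageD)
    qed (use f_A assms(2) in auto)
  qed
qed

section \<open>Existence, and the equivalence of the two formulations\<close>

theorem theorem1p1:
  fixes A :: "real set" and B :: "complex set"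
  assumes "countable A" and "closure A = UNIV"
    and "countable B" and "closure B = UNIV"
  shows "(\<exists>f. transcendental_entire f \<and>
            bij_betw f (complex_of_real ` A) B \<and>
            f -` B \<inter> \<real> = complex_of_real ` A)
       \<and> (\<forall>f. transcendental_entire f \<longrightarrow>
            (bij_betw f (complex_of_real ` A) B \<and> f -` B \<inter> \<real> = complex_of_real ` A
             \<longleftrightarrow>
             (\<forall>b\<in>B. \<exists>!x::real. f (complex_of_real x) = b) \<and>
             {x::real. \<exists>b\<in>B. f (complex_of_real x) = b} = A))"
proof (intro conjI allI impI)
  have "\<not> bounded (complex_of_real ` A)"
  proof
    assume "bounded (complex_of_real ` A)"
    then have "bounded A"
      by (auto simp: bounded_iff)
    then have "bounded (UNIV :: real set)"
      using assms(2) bounded_closure by metis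
    then show False
      by simp
  qed
  then obtain f where f: "f holomorphic_on UNIV" "bij_betw f (complex_of_real ` A) B"
      "f -` B \<inter> \<real> = complex_of_real ` A"
    using exists_entire_bijection[of "complex_of_real ` A" B] assms
    by (metis Reals_of_real countable_image image_subsetI)
  have "B \<subseteq> f ` \<real>"
    using f(2) unfolding bij_betw_def by (auto simp: Reals_def)
  then have "transcendental_entire f"
    using f(1) dense_subset_poly_image_Reals[OF assms(4)] by (auto simp: transcendental_entire_def)
  then show "\<exists>f. transcendental_entire f \<and> bij_betw f (complex_of_real ` A) B \<and>
      f -` B \<inter> \<real> = complex_of_real ` A"
    using f by blast
next
  fix f :: "complex \<Rightarrow> complex"
  show "bij_betw f (complex_of_real ` A) B \<and> f -` B \<inter> \<real> = complex_of_real ` A \<longleftrightarrow>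
      (\<forall>b\<in>B. \<exists>!x::real. f (complex_of_real x) = b) \<and> {x::real. \<exists>b\<in>B. f (complex_of_real x) = b} = A"
  proof -
    have "f -` B \<inter> \<real> = complex_of_real ` {x. \<exists>b\<in>B. f (complex_of_real x) = b}"
      by (auto simp: Reals_def)
    then have eq: "f -` B \<inter> \<real> = complex_of_real ` A \<longleftrightarrow> {x. \<exists>b\<in>B. f (complex_of_real x) = b} = A"
      by (simp add: inj_image_eq_iff inj_of_real)
    \<comment> \<open>Here a real number lies in \<open>A\<close> exactly if its value lies in
      \<open>B\<close>, so preimages of \<open>B\<close> in the reals and in \<open>A\<close>
      coincide.\<close>
    have bij: "bij_betw f (complex_of_real ` A) B \<longleftrightarrow> (\<forall>b\<in>B. \<exists>!x::real. f (complex_of_real x) = b)"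
      if A: "{x. \<exists>b\<in>B. f (complex_of_real x) = b} = A"
    proof
      assume L: "bij_betw f (complex_of_real ` A) B"
      show "\<forall>b\<in>B. \<exists>!x::real. f (complex_of_real x) = b"
      proof
        fix b assume "b \<in> B"
        then obtain x where "x \<in> A" "f (complex_of_real x) = b"
          using L unfolding bij_betw_def by auto
        moreover have "y = x" if "f (complex_of_real y) = b" for y
        proof -
          have "y \<in> A"
            using A that \<open>b \<in> B\<close> by blast
          then show ?thesis
            using L \<open>x \<in> A\<close> that \<open>f (complex_of_real x) = b\<close>
            unfolding bij_betw_def inj_on_def by (metis imageI of_real_eq_iff)
        qed
        ultimately show "\<exists>!x::real. f (complex_of_real x) = b"
          by blast
      qed
    next
      assume R: "\<forall>b\<in>B. \<exists>!x::real. f (complex_of_real x) = b"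
      have mem: "x \<in> A \<longleftrightarrow> f (complex_of_real x) \<in> B" for x
        using A by auto
      have "inj_on f (complex_of_real ` A)"
      proof (clarsimp simp: inj_on_def)
        fix x y assume "x \<in> A" "f (complex_of_real x) = f (complex_of_real y)"
        then show "x = y"
          using R mem by metis
      qed
      moreover have "f ` complex_of_real ` A = B"
      proof (intro equalityI subsetI)
        fix b assume "b \<in> B"
        then obtain x where "f (complex_of_real x) = b"
          using R by metis
        then show "b \<in> f ` complex_of_real ` A"
          using mem \<open>b \<in> B\<close> by blast
      qed (use mem in auto)
      ultimately show "bij_betw f (complex_of_real ` A) B"
        by (simp add: bij_betw_def)
    qed
    show ?thesis
    \<comment> \<open>If the set of real preimages differs from \<open>A\<close>, the conjunctions
      on both sides are false.\<close>
    proof (cases "{x. \<exists>b\<in>B. f (complex_of_real x) = b} = A")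
      case True
      then show ?thesis
        using eq bij[OF True] by (simp only: simp_thms)
    next
      case False
      then show ?thesis
        using eq by (simp only: simp_thms)
    qed
  qed
qed

end
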